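(* For each $p\in[1,\infty)$ the continuous embedding $\ell^1(w_p)\subseteq\mathscr{M}(d_p)$ holds.
   Context: Let $\mathbb{N}_0=\{0,1,2,\dots\}$. For $p\in[1,\infty)$, $d_p$ is the Banach space of all complex sequences $a=(a_n)_{n=0}^\infty$ with $\|a\|_{d_p}:=\big(\sum_{n=0}^\infty\sup_{k\ge n}|a_k|^p\big)^{1/p}<\infty$. The convolution of $a,b\in\mathbb{C}^{\mathbb{N}_0}$ is $(a*b)_n:=\sum_{j=0}^n a_jb_{n-j}$, $n\in\mathbb{N}_0$. The multiplier algebra of $d_p$ is $\mathscr{M}(d_p):=\{b\in\mathbb{C}^{\mathbb{N}_0}: a*b\in d_p \text{ for all } a\in d_p\}$, normed by $\|b\|_{\mathscr{M}(d_p)}:=\sup_{0\ne a\in d_p}\|a*b\|_{d_p}/\|a\|_{d_p}$ (which is finite for each $b\in\mathscr{M}(d_p)$). The weight is $w_p:=((n+1)^{1/p})_{n=0}^\infty$ and $\ell^1(w_p)$ is the space of complex sequences $a=(a_n)_{n=0}^\infty$ with $\|a\|_{1,w_p}:=\sum_{n=0}^\infty(n+1)^{1/p}|a_n|<\infty$, with this norm. *)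

theory Defs
  imports "HOL-Analysis.Analysis"
begin

text \<open>
  All norms take values in \<^typ>\<open>ennreal\<close> and are defined on the whole space of complex sequences,
  so that membership in \<open>d_p\<close> and in the weighted \<open>l1\<close> space is finiteness of the norm, and no
  junk values of real-valued suprema or infinite series enter. \<open>ennreal_powr\<close> is meant for
  exponents \<open>r > 0\<close>.
\<close>

definition ennreal_powr :: "ennreal \<Rightarrow> real \<Rightarrow> ennreal" where
  "ennreal_powr x r = (if x = \<infinity> then \<infinity> else ennreal (enn2real x powr r))"

definition dp_norm :: "real \<Rightarrow> (nat \<Rightarrow> complex) \<Rightarrow> ennreal" where
  "dp_norm p a = ennreal_powr (\<Sum>n. SUP k\<in>{n..}. ennreal (cmod (a k) powr p)) (1 / p)"

definition dp_space :: "real \<Rightarrow> (nat \<Rightarrow> complex) set" where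
  "dp_space p = {a. dp_norm p a < \<infinity>}"

definition conv :: "(nat \<Rightarrow> complex) \<Rightarrow> (nat \<Rightarrow> complex) \<Rightarrow> nat \<Rightarrow> complex" where
  "conv a b n = (\<Sum>j\<le>n. a j * b (n - j))"

definition dp_multipliers :: "real \<Rightarrow> (nat \<Rightarrow> complex) set" where
  "dp_multipliers p = {b. \<forall>a\<in>dp_space p. conv a b \<in> dp_space p}"

definition dp_multiplier_norm :: "real \<Rightarrow> (nat \<Rightarrow> complex) \<Rightarrow> ennreal" where
  "dp_multiplier_norm p b = (SUP a\<in>dp_space p - {\<lambda>_. 0}. dp_norm p (conv a b) / dp_norm p a)"

definition l1_weight_norm :: "(nat \<Rightarrow> real) \<Rightarrow> (nat \<Rightarrow> complex) \<Rightarrow> ennreal" where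
  "l1_weight_norm w a = (\<Sum>n. ennreal (w n * cmod (a n)))"

definition l1_weight_space :: "(nat \<Rightarrow> real) \<Rightarrow> (nat \<Rightarrow> complex) set" where
  "l1_weight_space w = {a. l1_weight_norm w a < \<infinity>}"

definition dp_weight :: "real \<Rightarrow> nat \<Rightarrow> real" where
  "dp_weight p n = (real n + 1) powr (1 / p)"

text \<open>
  \<open>X\<close> is contained in \<open>Y\<close> and the inclusion map is continuous with respect to the metrics
  induced by the norms \<open>NX\<close> and \<open>NY\<close>.
\<close>

definition continuously_embedded ::
  "(nat \<Rightarrow> complex) set \<Rightarrow> ((nat \<Rightarrow> complex) \<Rightarrow> ennreal) \<Rightarrow>
   (nat \<Rightarrow> complex) set \<Rightarrow> ((nat \<Rightarrow> complex) \<Rightarrow> ennreal) \<Rightarrow> bool" where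
  "continuously_embedded X NX Y NY \<longleftrightarrow>
     X \<subseteq> Y \<and>
     (\<forall>x\<in>X. \<forall>\<epsilon>::real>0. \<exists>\<delta>::real>0. \<forall>y\<in>X.
        NX (\<lambda>n. y n - x n) < ennreal \<delta> \<longrightarrow> NY (\<lambda>n. y n - x n) < ennreal \<epsilon>)"

end

theory Submission
  imports Defs
begin

text \<open>
  Write \<open>W = \<parallel>b\<parallel>\<^sub>1\<^sub>,\<^sub>w\<close> and \<open>S n = sup\<^bsub>k \<ge> n\<^esub> |a k|\<^sup>p\<close>, so that \<open>\<parallel>a\<parallel>\<^sup>p = \<Sum>n. S n\<close> in \<open>d\<^sub>p\<close>. Everything
  follows from \<open>\<parallel>a * b\<parallel> \<le> W \<parallel>a\<parallel>\<close>. The geometric reason for this bound is that shifting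
  a sequence to the right by \<open>j\<close> replaces \<open>S n\<close> by \<open>S (n - j)\<close> with truncated subtraction: the first
  \<open>j\<close> suprema become \<open>S 0\<close>. Hence the shift multiplies \<open>\<parallel>a\<parallel>\<^sup>p\<close> by at most \<open>j + 1 = (w j)\<^sup>p\<close>
  (\<open>suminf_truncated_shift_le\<close>), and \<open>a * b\<close> is the sum of the shifts of \<open>a\<close> weighted by \<open>b\<close>.

  Instead of adding the norms of the shifts by Minkowski's inequality for infinite sums, the proof
  applies Jensen's inequality at each index (\<open>powr_sum_mult_le\<close>) to
  \<open>\<Sum>j. |b j| |a (k - j)| = \<Sum>j. v j * (|a (k - j)| / w j)\<close> with masses \<open>v j = |b j| w j\<close> of total
  mass \<open>W\<close>. The factors \<open>1 / (w j)\<^sup>p = 1 / (j + 1)\<close> that this produces cancel the growth of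
  the shifts exactly, and it remains to exchange two sums of nonnegative terms.
\<close>

section \<open>Powers and double sums of extended nonnegative reals\<close>

lemma ennreal_powr_mono:
  assumes "x \<le> y" "0 \<le> r"
  shows "ennreal_powr x r \<le> ennreal_powr y r"
  using assms unfolding ennreal_powr_def
  by (auto intro!: ennreal_leI powr_mono2 enn2real_mono simp: top_unique less_top)

lemma ennreal_powr_mult:
  assumes "0 \<le> c" "0 < r"
  shows "ennreal_powr (ennreal c * x) r = ennreal (c powr r) * ennreal_powr x r"
proof (cases "x = top")
  case True
  then show ?thesis
    using assms by (cases "c = 0") (auto simp: ennreal_powr_def ennreal_mult_top)
next
  case False
  then have "ennreal c * x \<noteq> top"
    by (simp add: ennreal_mult_eq_top_iff)
  with False show ?thesis
    using assms by (simp add: ennreal_powr_def enn2real_mult powr_mult ennreal_mult')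
qed

text \<open>
  This is the monotone convergence theorem for counting measure.
\<close>

lemma suminf_swap_ennreal:
  fixes f :: "nat \<Rightarrow> nat \<Rightarrow> ennreal"
  shows "(\<Sum>i j. f i j) = (\<Sum>j i. f i j)"
proof -
  have "(\<integral>\<^sup>+i. (\<Sum>j. f i j) \<partial>count_space UNIV) = (\<Sum>j. \<integral>\<^sup>+i. f i j \<partial>count_space UNIV)"
    by (rule nn_integral_suminf) simp
  then show ?thesis
    by (simp add: nn_integral_count_space_nat)
qed

section \<open>Convexity and truncated shifts\<close>

text \<open>
  At the end point \<open>0\<close>, where the second derivative is not available for \<open>p < 2\<close>, convexity
  reduces to \<open>t\<^sup>p \<le> t\<close> for \<open>0 < t < 1\<close>.
\<close>

lemma convex_on_powr_nonneg:
  fixes p :: real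
  assumes p: "1 \<le> p"
  shows "convex_on {0..} (\<lambda>x. x powr p)"
proof (rule convex_on_linorderI)
  fix t x y :: real
  assume t: "0 < t" "t < 1" and xy: "x \<in> {0..}" "y \<in> {0..}" "x < y"
  show "((1 - t) *\<^sub>R x + t *\<^sub>R y) powr p \<le> (1 - t) * x powr p + t * y powr p"
  proof (cases "x = 0")
    case True
    have "t powr p \<le> t powr 1"
      using t p by (intro powr_mono') auto
    then show ?thesis
      using True t xy by (simp add: powr_mult mult_right_mono)
  next
    case False
    then show ?thesis
      using convex_onD[OF powr_convex[OF p], of t x y] t xy by simp
  qed
qed (rule convex_real_interval)

text \<open>
  This is Jensen's inequality for the power function, with masses that need not have sum one.
  Allowing any upper bound \<open>W\<close> for the total mass lets all finite partial sums share the
  constant of the infinite sum.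
\<close>

lemma powr_sum_mult_le:
  fixes v x :: "'i \<Rightarrow> real"
  assumes fin: "finite J" and v: "\<And>j. j \<in> J \<Longrightarrow> 0 \<le> v j" and x: "\<And>j. j \<in> J \<Longrightarrow> 0 \<le> x j"
    and W: "sum v J \<le> W" and p: "1 \<le> p"
  shows "(\<Sum>j\<in>J. v j * x j) powr p \<le> W powr (p - 1) * (\<Sum>j\<in>J. v j * x j powr p)"
proof (cases "sum v J = 0")
  case True
  then have "\<And>j. j \<in> J \<Longrightarrow> v j = 0"
    using sum_nonneg_eq_0_iff[OF fin] v by blast
  then show ?thesis by simp
next
  case False
  define V where "V = sum v J"
  have V: "0 < V"
    using False v by (simp add: V_def sum_nonneg order_less_le)
  have "(\<Sum>j\<in>J. (v j / V) *\<^sub>R x j) powr p \<le> (\<Sum>j\<in>J. (v j / V) * x j powr p)"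
  proof (rule convex_on_sum[OF fin _ convex_on_powr_nonneg[OF p]])
    show "J \<noteq> {}" using False by auto
    show "(\<Sum>j\<in>J. v j / V) = 1"
      using V by (simp add: V_def flip: sum_divide_distrib)
  qed (use p v x V in auto)
  then have "((\<Sum>j\<in>J. v j * x j) / V) powr p \<le> (\<Sum>j\<in>J. v j * x j powr p) / V"
    by (simp add: sum_divide_distrib)
  moreover have "((\<Sum>j\<in>J. v j * x j) / V) powr p = (\<Sum>j\<in>J. v j * x j) powr p / V powr p"
    by (rule powr_divide)
  ultimately have "(\<Sum>j\<in>J. v j * x j) powr p \<le> (\<Sum>j\<in>J. v j * x j powr p) / V * V powr p"
    using V by (simp add: divide_le_eq)
  also have "\<dots> = V powr (p - 1) * (\<Sum>j\<in>J. v j * x j powr p)"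
    using V by (simp add: powr_diff)
  also have "\<dots> \<le> W powr (p - 1) * (\<Sum>j\<in>J. v j * x j powr p)"
    using V W p v x by (intro mult_right_mono powr_mono2 sum_nonneg) (auto simp: V_def)
  finally show ?thesis .
qed

text \<open>
  The shifted sequence consists of \<open>j\<close> copies of \<open>S 0\<close> followed by \<open>S\<close> itself, and \<open>S 0\<close> is
  at most the sum of \<open>S\<close>.
\<close>

lemma suminf_truncated_shift_le:
  fixes S :: "nat \<Rightarrow> ennreal"
  shows "(\<Sum>n. S (n - j)) \<le> ennreal (real j + 1) * (\<Sum>n. S n)"
proof -
  have "(\<Sum>n. S (n - j)) = (\<Sum>n. S (n + j - j)) + (\<Sum>n<j. S (n - j))"
    by (rule suminf_offset) (rule summableI)
  also have "(\<Sum>n<j. S (n - j)) = of_nat j * S 0"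
    by simp
  also have "\<dots> \<le> of_nat j * (\<Sum>n. S n)"
    using sum_le_suminf[of S "{0}"] by (intro mult_left_mono) (auto intro: summableI)
  finally have "(\<Sum>n. S (n - j)) \<le> (1 + of_nat j) * (\<Sum>n. S n)"
    by (simp add: distrib_right)
  moreover have "ennreal (real j + 1) = 1 + of_nat j"
    by (simp add: ennreal_of_nat_eq_real_of_nat add.commute)
  ultimately show ?thesis by (simp only:)
qed

section \<open>The convolution estimate\<close>

lemma conv_commute: "conv a b n = (\<Sum>j\<le>n. b j * a (n - j))"
  unfolding conv_def
  by (rule sum.reindex_bij_witness[of _ "\<lambda>j. n - j" "\<lambda>j. n - j"]) auto

text \<open>
  With \<open>v j = (w j) |b j|\<close> and \<open>x j = |a (k - j)| / w j\<close>, the inequality of Jensen has the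
  factor \<open>(w j)\<^sup>p = j + 1\<close> in the denominator.
\<close>

lemma norm_conv_powr_le:
  fixes p W :: real
  assumes p: "1 \<le> p" and W: "(\<Sum>j\<le>k. dp_weight p j * cmod (b j)) \<le> W"
  shows "cmod (conv a b k) powr p
    \<le> W powr (p - 1) * (\<Sum>j\<le>k. dp_weight p j * cmod (b j) / (real j + 1) * cmod (a (k - j)) powr p)"
proof -
  have w: "0 < dp_weight p j" "dp_weight p j powr p = real j + 1" for j
    using p by (auto simp: dp_weight_def powr_powr)
  have "cmod (conv a b k) \<le> (\<Sum>j\<le>k. cmod (b j) * cmod (a (k - j)))"
    unfolding conv_commute by (rule order.trans[OF norm_sum]) (simp add: norm_mult)
  also have "\<dots> = (\<Sum>j\<le>k. (dp_weight p j * cmod (b j)) * (cmod (a (k - j)) / dp_weight p j))"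
    using w(1) by (intro sum.cong refl) (simp add: field_simps less_imp_neq[THEN not_sym])
  finally have "cmod (conv a b k) powr p
      \<le> (\<Sum>j\<le>k. (dp_weight p j * cmod (b j)) * (cmod (a (k - j)) / dp_weight p j)) powr p"
    using p by (intro powr_mono2) auto
  also have "\<dots> \<le> W powr (p - 1)
      * (\<Sum>j\<le>k. (dp_weight p j * cmod (b j)) * (cmod (a (k - j)) / dp_weight p j) powr p)"
    using w(1) by (intro powr_sum_mult_le p W) (auto simp: less_imp_le)
  also have "\<dots> = W powr (p - 1)
      * (\<Sum>j\<le>k. dp_weight p j * cmod (b j) / (real j + 1) * cmod (a (k - j)) powr p)"
    using w by (simp add: powr_divide less_imp_le)
  finally show ?thesis .
qed

text \<open>
  For \<open>k \<ge> n\<close> and \<open>j \<le> k\<close> the index \<open>k - j\<close> is at least the truncated difference \<open>n - j\<close>, so the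
  bound for a single index \<open>k\<close> becomes uniform over \<open>k \<ge> n\<close> once \<open>|a (k - j)|\<^sup>p\<close> is replaced
  by the supremum at \<open>n - j\<close>.
\<close>

lemma suminf_SUP_conv_le:
  fixes p W :: real
  assumes p: "1 \<le> p" and W: "0 \<le> W" "l1_weight_norm (dp_weight p) b = ennreal W"
  shows "(\<Sum>n. SUP k\<in>{n..}. ennreal (cmod (conv a b k) powr p))
    \<le> ennreal (W powr p) * (\<Sum>n. SUP k\<in>{n..}. ennreal (cmod (a k) powr p))"
proof -
  define v where "v j = dp_weight p j * cmod (b j)" for j
  define S where "S n = (SUP k\<in>{n..}. ennreal (cmod (a k) powr p))" for n
  have v: "0 \<le> v j" for j
    by (simp add: v_def dp_weight_def)
  have cancel: "ennreal (v j / (real j + 1)) * ennreal (real j + 1) = ennreal (v j)" for j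
    using v by (subst ennreal_mult[symmetric]) (auto simp: add_pos_nonneg add_eq_0_iff)
  have suminf_v: "(\<Sum>j. ennreal (v j)) = ennreal W"
    using W by (simp add: l1_weight_norm_def v_def)
  have sum_v: "(\<Sum>j\<le>k. v j) \<le> W" for k
  proof -
    have "ennreal (\<Sum>j\<le>k. v j) = (\<Sum>j\<le>k. ennreal (v j))"
      using v by simp
    also have "\<dots> \<le> ennreal W"
      unfolding suminf_v[symmetric] by (rule sum_le_suminf) (auto intro: summableI)
    finally show ?thesis using W by simp
  qed
  have single: "ennreal (cmod (conv a b k) powr p)
      \<le> ennreal (W powr (p - 1)) * (\<Sum>j. ennreal (v j / (real j + 1)) * S (n - j))"
    if "n \<le> k" for n k
  proof -
    have "ennreal (cmod (conv a b k) powr p)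
        \<le> ennreal (W powr (p - 1) * (\<Sum>j\<le>k. v j / (real j + 1) * cmod (a (k - j)) powr p))"
      using norm_conv_powr_le[OF p, of b k W a] sum_v by (intro ennreal_leI) (simp add: v_def)
    also have "\<dots> = ennreal (W powr (p - 1))
        * (\<Sum>j\<le>k. ennreal (v j / (real j + 1)) * ennreal (cmod (a (k - j)) powr p))"
      using v by (simp add: ennreal_mult sum_nonneg flip: sum_ennreal del: times_divide_eq_left)
    also have "\<dots> \<le> ennreal (W powr (p - 1)) * (\<Sum>j\<le>k. ennreal (v j / (real j + 1)) * S (n - j))"
      unfolding S_def using that by (intro mult_left_mono sum_mono SUP_upper) auto
    also have "\<dots> \<le> ennreal (W powr (p - 1)) * (\<Sum>j. ennreal (v j / (real j + 1)) * S (n - j))"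
      by (intro mult_left_mono sum_le_suminf) (auto intro: summableI)
    finally show ?thesis .
  qed
  have "(\<Sum>n. SUP k\<in>{n..}. ennreal (cmod (conv a b k) powr p))
      \<le> (\<Sum>n. ennreal (W powr (p - 1)) * (\<Sum>j. ennreal (v j / (real j + 1)) * S (n - j)))"
    by (intro suminf_le summableI SUP_least single) simp
  also have "\<dots> = ennreal (W powr (p - 1)) * (\<Sum>n j. ennreal (v j / (real j + 1)) * S (n - j))"
    by (rule ennreal_suminf_cmult)
  also have "(\<Sum>n j. ennreal (v j / (real j + 1)) * S (n - j))
      = (\<Sum>j n. ennreal (v j / (real j + 1)) * S (n - j))"
    by (rule suminf_swap_ennreal)
  also have "\<dots> = (\<Sum>j. ennreal (v j / (real j + 1)) * (\<Sum>n. S (n - j)))"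
    by simp
  also have "\<dots> \<le> (\<Sum>j. ennreal (v j / (real j + 1)) * (ennreal (real j + 1) * (\<Sum>n. S n)))"
    by (intro suminf_le summableI mult_left_mono suminf_truncated_shift_le) simp
  also have "\<dots> = (\<Sum>j. ennreal (v j) * (\<Sum>n. S n))"
    by (simp only: mult.assoc[symmetric] cancel)
  also have "\<dots> = ennreal W * (\<Sum>n. S n)"
    by (simp add: suminf_v)
  finally have "(\<Sum>n. SUP k\<in>{n..}. ennreal (cmod (conv a b k) powr p))
      \<le> ennreal (W powr (p - 1)) * (ennreal W * (\<Sum>n. S n))"
    by (simp add: mult_left_mono)
  moreover have "ennreal (W powr (p - 1)) * ennreal W = ennreal (W powr p)"
    using W by (cases "W = 0") (simp_all add: powr_diff flip: ennreal_mult)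
  ultimately show ?thesis
    by (simp add: S_def mult.assoc[symmetric])
qed

lemma dp_norm_conv_le:
  assumes p: "1 \<le> p" and b: "l1_weight_norm (dp_weight p) b < \<infinity>"
  shows "dp_norm p (conv a b) \<le> l1_weight_norm (dp_weight p) b * dp_norm p a"
proof -
  obtain W where W: "0 \<le> W" "l1_weight_norm (dp_weight p) b = ennreal W"
    using b by (cases "l1_weight_norm (dp_weight p) b") auto
  have "dp_norm p (conv a b)
      \<le> ennreal_powr (ennreal (W powr p) * (\<Sum>n. SUP k\<in>{n..}. ennreal (cmod (a k) powr p))) (1 / p)"
    unfolding dp_norm_def using p by (intro ennreal_powr_mono suminf_SUP_conv_le W) auto
  also have "\<dots> = ennreal W * dp_norm p a"
    using p W by (simp add: ennreal_powr_mult dp_norm_def powr_powr)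
  finally show ?thesis by (simp add: W)
qed

lemma l1_weight_space_subset_dp_multipliers:
  assumes "1 \<le> p"
  shows "l1_weight_space (dp_weight p) \<subseteq> dp_multipliers p"
  using order.strict_trans1[OF dp_norm_conv_le[OF assms]]
  by (auto simp: l1_weight_space_def dp_multipliers_def dp_space_def ennreal_mult_less_top)

text \<open>
  The embedding has norm at most one, which gives continuity with \<open>\<delta> = \<epsilon>\<close>.
\<close>

lemma dp_multiplier_norm_le:
  assumes p: "1 \<le> p" and b: "l1_weight_norm (dp_weight p) b < \<infinity>"
  shows "dp_multiplier_norm p b \<le> l1_weight_norm (dp_weight p) b"
  unfolding dp_multiplier_norm_def
proof (rule SUP_least)
  fix a assume "a \<in> dp_space p - {\<lambda>_. 0}"
  then have fin: "dp_norm p a < \<infinity>"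
    by (simp add: dp_space_def)
  note bound = dp_norm_conv_le[OF p b, of a]
  show "dp_norm p (conv a b) / dp_norm p a \<le> l1_weight_norm (dp_weight p) b"
  proof (cases "dp_norm p a = 0")
    case True
    then show ?thesis using bound by simp
  next
    case False
    have "dp_norm p (conv a b) / dp_norm p a
        \<le> l1_weight_norm (dp_weight p) b * dp_norm p a / dp_norm p a"
      by (rule divide_right_mono_ennreal[OF bound])
    also have "\<dots> = l1_weight_norm (dp_weight p) b"
      using False fin by (simp add: ennreal_mult_divide_eq)
    finally show ?thesis .
  qed
qed

theorem proposition4p4:
  fixes p :: real
  assumes "1 \<le> p"
  shows "continuously_embedded
           (l1_weight_space (dp_weight p)) (l1_weight_norm (dp_weight p))
           (dp_multipliers p) (dp_multiplier_norm p)"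
  unfolding continuously_embedded_def
proof (intro conjI ballI allI impI l1_weight_space_subset_dp_multipliers assms)
  fix x and \<epsilon> :: real
  assume \<epsilon>: "0 < \<epsilon>"
  have "dp_multiplier_norm p (\<lambda>n. y n - x n) < ennreal \<epsilon>"
    if "l1_weight_norm (dp_weight p) (\<lambda>n. y n - x n) < ennreal \<epsilon>" for y
  proof -
    have "l1_weight_norm (dp_weight p) (\<lambda>n. y n - x n) < \<infinity>"
      using that ennreal_less_top[of \<epsilon>] by (auto intro: order.strict_trans)
    from dp_multiplier_norm_le[OF assms this] that show ?thesis
      by (rule order.strict_trans1)
  qed
  with \<epsilon> show "\<exists>\<delta>>0. \<forall>y\<in>l1_weight_space (dp_weight p).
      l1_weight_norm (dp_weight p) (\<lambda>n. y n - x n) < ennreal \<delta> \<longrightarrow>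
      dp_multiplier_norm p (\<lambda>n. y n - x n) < ennreal \<epsilon>"
    by blast
qed

end
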